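(* Let $0<\alpha<1$, $\kappa>0$, $p>0$, $a<b$, $T>0$, $M,N\in\mathbb{N}^+$, $h=(b-a)/M$, $\tau=T/N$. Then the $(M+1)\times(M+1)$ coefficient matrices $\mathbf{A}$ and $\mathbf{K}$ defined in the context are strictly diagonally dominant (by rows). Consequently the exponential B-spline collocation scheme is uniquely solvable: the initial system $$\mathbf{K}\boldsymbol{\alpha}^0=\mathbf{U}$$ has exactly one solution $\boldsymbol{\alpha}^0\in\mathbb{R}^{M+1}$, and for each $n=1,\dots,N$, given $\boldsymbol{\alpha}^0,\dots,\boldsymbol{\alpha}^{n-1}$, the system $$\mathbf{A}\boldsymbol{\alpha}^n=-\sum_{k=1}^{n-1}\omega^\alpha_k\mathbf{B}\boldsymbol{\alpha}^{n-k}+\sum_{k=0}^{n-1}\omega^\alpha_k\mathbf{B}\boldsymbol{\alpha}^0+\mathbf{F}^n$$ has exactly one solution $\boldsymbol{\alpha}^n\in\mathbb{R}^{M+1}$.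
   Context: The scheme discretizes the fractional sub-diffusion problem $\partial_t^\alpha u-\kappa\,\partial_x^2u=f(x,t)$ on $a<x<b$, $0<t\le T$ (Caputo derivative in time, $0<\alpha<1$), with $u(x,0)=\varphi(x)$, $u(a,t)=g_1(t)$, $u(b,t)=g_2(t)$, where $\varphi,g_1,g_2$ are sufficiently smooth real functions. Grid: $x_j=a+jh$, $t_n=n\tau$; write $f_j^n=f(x_j,t_n)$, $g_i^n=g_i(t_n)$, $\varphi_j=\varphi(x_j)$. The constant $p>0$ is the tension parameter, and $s=\sinh(ph)$, $c=\cosh(ph)$. The coefficients are $\omega^\alpha_k=(-1)^k\binom{\alpha}{k}$, $k\ge 0$ (so $\omega_0^\alpha=1$). Empty sums are $0$. Put $$A=-\tau^\alpha\kappa p^2s+\omega^\alpha_0(s-ph),\qquad A'=2\tau^\alpha\kappa p^2s+2\omega^\alpha_0(phc-s).$$ All matrices are tri-diagonal of size $(M+1)\times(M+1)$, with rows and columns indexed by $0,1,\dots,M$; entries not listed are zero. - $\mathbf{A}$: $\mathbf{A}_{00}=\mathbf{A}_{MM}=2\tau^\alpha\kappa p^3hs(c-1)$, with all other entries in rows $0$ and $M$ zero; for $1\le j\le M-1$, $\mathbf{A}_{j,j-1}=\mathbf{A}_{j,j+1}=A$ and $\mathbf{A}_{jj}=A'$. - $\mathbf{B}$: rows $0$ and $M$ are zero; for $1\le j\le M-1$, $\mathbf{B}_{j,j\pm1}=s-ph$ and $\mathbf{B}_{jj}=2(phc-s)$. - $\mathbf{K}$: $\mathbf{K}_{00}=\mathbf{K}_{MM}=phc-s$,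 $\mathbf{K}_{01}=\mathbf{K}_{M,M-1}=s-ph$; for $1\le j\le M-1$, $\mathbf{K}_{j,j\pm1}=s-ph$ and $\mathbf{K}_{jj}=2(phc-s)$. Right-hand sides: $\mathbf{F}^n=(phc-s)\,\big(2\tau^\alpha(s-ph)f_0^n+d_0^n,\;2\tau^\alpha f_1^n,\dots,2\tau^\alpha f_{M-1}^n,\;2\tau^\alpha(s-ph)f_M^n+d_M^n\big)^{T}$, where $$d_0^n=-2(s-ph)\sum_{k=0}^{n-1}\omega_k^\alpha g_1^{n-k}+2(s-ph)\sum_{k=0}^{n-1}\omega_k^\alpha\varphi_0+2\tau^\alpha\kappa p^2s\,g_1^n,$$ $$d_M^n=-2(s-ph)\sum_{k=0}^{n-1}\omega_k^\alpha g_2^{n-k}+2(s-ph)\sum_{k=0}^{n-1}\omega_k^\alpha\varphi_M+2\tau^\alpha\kappa p^2s\,g_2^n,$$ and $$\mathbf{U}=(phc-s)\Big(\varphi_0-\tfrac{(s-ph)\varphi'(x_0)}{p(1-c)},\;2\varphi_1,\dots,2\varphi_{M-1},\;\varphi_M+\tfrac{(s-ph)\varphi'(x_M)}{p(1-c)}\Big)^{T}.$$ Strictly diagonally dominant by rows means $|m_{jj}|>\sum_{l\ne j}|m_{jl}|$ for every row $j$. *)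

theory Defs
  imports Complex_Main "Jordan_Normal_Form.Matrix"
begin

text \<open>
  Throughout, \<open>al\<close> is the order of the Caputo derivative, \<open>kappa\<close> the diffusion coefficient,
  \<open>p\<close> the tension parameter, \<open>h\<close> and \<open>tau\<close> are the mesh sizes and \<open>M\<close> is the number of
  spatial intervals; rows and columns are indexed by \<open>0, ..., M\<close>.
\<close>

definition strictly_diag_dominant :: "real mat \<Rightarrow> bool" where
  "strictly_diag_dominant X \<longleftrightarrow> square_mat X \<and>
     (\<forall>j<dim_row X. \<bar>X $$ (j, j)\<bar> > (\<Sum>l\<in>{0..<dim_col X} - {j}. \<bar>X $$ (j, l)\<bar>))"

definition omega :: "real \<Rightarrow> nat \<Rightarrow> real" where
  "omega al k = (-1) ^ k * (al gchoose k)"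

definition coeff_A :: "real \<Rightarrow> real \<Rightarrow> real \<Rightarrow> real \<Rightarrow> real \<Rightarrow> real" where
  "coeff_A al kappa p h tau = (let s = sinh (p * h) in
     - (tau powr al) * kappa * p ^ 2 * s + omega al 0 * (s - p * h))"

definition coeff_A' :: "real \<Rightarrow> real \<Rightarrow> real \<Rightarrow> real \<Rightarrow> real \<Rightarrow> real" where
  "coeff_A' al kappa p h tau = (let s = sinh (p * h); c = cosh (p * h) in
     2 * (tau powr al) * kappa * p ^ 2 * s + 2 * omega al 0 * (p * h * c - s))"

definition mat_A :: "real \<Rightarrow> real \<Rightarrow> real \<Rightarrow> real \<Rightarrow> real \<Rightarrow> nat \<Rightarrow> real mat" where
  "mat_A al kappa p h tau M = (let s = sinh (p * h); c = cosh (p * h) in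
     mat (M + 1) (M + 1) (\<lambda>(j, l).
       if j = 0 \<or> j = M then
         (if l = j then 2 * (tau powr al) * kappa * p ^ 3 * h * s * (c - 1) else 0)
       else if l = j then coeff_A' al kappa p h tau
       else if l + 1 = j \<or> l = j + 1 then coeff_A al kappa p h tau
       else 0))"

definition mat_B :: "real \<Rightarrow> real \<Rightarrow> nat \<Rightarrow> real mat" where
  "mat_B p h M = (let s = sinh (p * h); c = cosh (p * h) in
     mat (M + 1) (M + 1) (\<lambda>(j, l).
       if j = 0 \<or> j = M then 0
       else if l = j then 2 * (p * h * c - s)
       else if l + 1 = j \<or> l = j + 1 then s - p * h
       else 0))"

definition mat_K :: "real \<Rightarrow> real \<Rightarrow> nat \<Rightarrow> real mat" where
  "mat_K p h M = (let s = sinh (p * h); c = cosh (p * h) in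
     mat (M + 1) (M + 1) (\<lambda>(j, l).
       if l = j then (if j = 0 \<or> j = M then p * h * c - s else 2 * (p * h * c - s))
       else if l + 1 = j \<or> l = j + 1 then s - p * h
       else 0))"

text \<open>
  The boundary terms \<open>d\<^sub>0\<^sup>n\<close> and \<open>d\<^sub>M\<^sup>n\<close> have the same form: \<open>g\<close> is the
  boundary datum at the end point concerned and \<open>phi0\<close> the value of the initial datum there.
\<close>

definition bdry_d ::
  "real \<Rightarrow> real \<Rightarrow> real \<Rightarrow> real \<Rightarrow> real \<Rightarrow> (real \<Rightarrow> real) \<Rightarrow> real \<Rightarrow> nat \<Rightarrow> real" where
  "bdry_d al kappa p h tau g phi0 n = (let s = sinh (p * h) in
     - 2 * (s - p * h) * (\<Sum>k<n. omega al k * g (real (n - k) * tau))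
     + 2 * (s - p * h) * (\<Sum>k<n. omega al k * phi0)
     + 2 * (tau powr al) * kappa * p ^ 2 * s * g (real n * tau))"

definition rhs_F ::
  "real \<Rightarrow> real \<Rightarrow> real \<Rightarrow> real \<Rightarrow> real \<Rightarrow> real \<Rightarrow> nat \<Rightarrow> (real \<Rightarrow> real \<Rightarrow> real) \<Rightarrow> (real \<Rightarrow> real)
    \<Rightarrow> (real \<Rightarrow> real) \<Rightarrow> (real \<Rightarrow> real) \<Rightarrow> nat \<Rightarrow> real vec" where
  "rhs_F al kappa p a h tau M f phi g1 g2 n =
    (let s = sinh (p * h); c = cosh (p * h);
         x = (\<lambda>j. a + real j * h); t = real n * tau in
     (p * h * c - s) \<cdot>\<^sub>v vec (M + 1) (\<lambda>j.
       if j = 0 then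
         2 * (tau powr al) * (s - p * h) * f (x 0) t + bdry_d al kappa p h tau g1 (phi (x 0)) n
       else if j = M then
         2 * (tau powr al) * (s - p * h) * f (x M) t + bdry_d al kappa p h tau g2 (phi (x M)) n
       else 2 * (tau powr al) * f (x j) t))"

text \<open>Here \<open>phi'\<close> stands for the derivative of \<open>phi\<close>.\<close>

definition rhs_U ::
  "real \<Rightarrow> real \<Rightarrow> real \<Rightarrow> nat \<Rightarrow> (real \<Rightarrow> real) \<Rightarrow> (real \<Rightarrow> real) \<Rightarrow> real vec" where
  "rhs_U p a h M phi phi' =
    (let s = sinh (p * h); c = cosh (p * h); x = (\<lambda>j. a + real j * h) in
     (p * h * c - s) \<cdot>\<^sub>v vec (M + 1) (\<lambda>j.
       if j = 0 then phi (x 0) - (s - p * h) * phi' (x 0) / (p * (1 - c))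
       else if j = M then phi (x M) + (s - p * h) * phi' (x M) / (p * (1 - c))
       else 2 * phi (x j)))"

end

theory Submission
  imports Defs "Jordan_Normal_Form.Determinant"
begin

text \<open>Both systems are tri-diagonal, and dominance of their rows reduces to the inequalities
  \<open>0 \<le> sinh z - z < z cosh z - sinh z\<close> for \<open>z > 0\<close>. The second one is \<open>tanh y < y\<close> at
  \<open>y = z/2\<close>, by the double angle formulas. A strictly diagonally dominant matrix is nonsingular,
  as one sees at a coordinate of largest modulus of a vector in its kernel.\<close>

lemma strictly_diag_dominant_det_nonzero:
  fixes X :: "real mat"
  assumes X: "X \<in> carrier_mat n n" and dom: "strictly_diag_dominant X"
  shows "det X \<noteq> 0"
proof
  assume "det X = 0"
  then obtain v where v: "v \<in> carrier_vec n" "v \<noteq> 0\<^sub>v n" "X *\<^sub>v v = 0\<^sub>v n"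
    using det_0_iff_vec_prod_zero[OF X] by blast
  then obtain i where i: "i < n" "v $ i \<noteq> 0"
    by (metis carrier_vecD eq_vecI index_zero_vec)
  let ?V = "(\<lambda>k. \<bar>v $ k\<bar>) ` {0..<n}"
  have "Max ?V \<in> ?V"
    using i(1) by (intro Max_in) auto
  then obtain j where j: "j < n" "\<bar>v $ j\<bar> = Max ?V"
    by force
  have le: "\<bar>v $ l\<bar> \<le> \<bar>v $ j\<bar>" if "l < n" for l
    using that unfolding j(2) by (intro Max_ge) auto
  \<comment> \<open>A nonzero coordinate \<open>i\<close> forces the largest modulus to be positive;
    this keeps the final multiplication by it strict.\<close>
  have pos: "\<bar>v $ j\<bar> > 0"
    using le[OF i(1)] i(2) by linarith
  \<comment> \<open>Row \<open>j\<close> of the kernel equation balances the diagonal term against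
    all the others. Bounding each coordinate by the largest one then contradicts dominance of row
    \<open>j\<close>, as the chain ends in a number smaller than itself.\<close>
  have "0 = (X *\<^sub>v v) $ j"
    using v(3) j(1) by simp
  also have "\<dots> = (\<Sum>l = 0..<n. X $$ (j, l) * v $ l)"
    using X v(1) j(1) by (simp add: scalar_prod_def)
  also have "\<dots> = X $$ (j, j) * v $ j + (\<Sum>l \<in> {0..<n} - {j}. X $$ (j, l) * v $ l)"
    using j(1) by (intro sum.remove) auto
  finally have "\<bar>X $$ (j, j) * v $ j\<bar> = \<bar>\<Sum>l \<in> {0..<n} - {j}. X $$ (j, l) * v $ l\<bar>"
    by linarith
  also have "\<dots> \<le> (\<Sum>l \<in> {0..<n} - {j}. \<bar>X $$ (j, l)\<bar> * \<bar>v $ l\<bar>)"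
    using sum_abs[of "\<lambda>l. X $$ (j, l) * v $ l"] by (simp add: abs_mult)
  also have "\<dots> \<le> (\<Sum>l \<in> {0..<n} - {j}. \<bar>X $$ (j, l)\<bar> * \<bar>v $ j\<bar>)"
    using le by (intro sum_mono mult_left_mono) auto
  also have "\<dots> = (\<Sum>l \<in> {0..<n} - {j}. \<bar>X $$ (j, l)\<bar>) * \<bar>v $ j\<bar>"
    by (simp add: sum_distrib_right)
  also have "\<dots> < \<bar>X $$ (j, j)\<bar> * \<bar>v $ j\<bar>"
    using dom X j(1) pos unfolding strictly_diag_dominant_def
    by (intro mult_strict_right_mono) auto
  finally show False
    by (simp add: abs_mult)
qed

text \<open>A nonzero determinant makes \<open>X\<close> a unit of the matrix ring, with two-sided
  inverse \<open>Y\<close>. From \<open>X * Y = 1\<close> comes existence, from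
  \<open>Y * X = 1\<close> uniqueness.\<close>

lemma strictly_diag_dominant_ex1_solution:
  fixes X :: "real mat"
  assumes X: "X \<in> carrier_mat n n" and dom: "strictly_diag_dominant X" and b: "b \<in> carrier_vec n"
  shows "\<exists>!v. v \<in> carrier_vec n \<and> X *\<^sub>v v = b"
proof -
  have "X \<in> Units (ring_mat TYPE(real) n ())"
    by (rule det_non_zero_imp_unit[OF X strictly_diag_dominant_det_nonzero[OF X dom]])
  then obtain Y where Y: "Y \<in> carrier_mat n n" "Y * X = 1\<^sub>m n" "X * Y = 1\<^sub>m n"
    unfolding Units_def by (auto simp: ring_mat_simps)
  show ?thesis
  proof (rule ex1I[of _ "Y *\<^sub>v b"])
    show "Y *\<^sub>v b \<in> carrier_vec n \<and> X *\<^sub>v (Y *\<^sub>v b) = b"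
      using assoc_mult_mat_vec[OF X Y(1) b] X Y b by auto
  next
    fix v
    assume "v \<in> carrier_vec n \<and> X *\<^sub>v v = b"
    then show "v = Y *\<^sub>v b"
      using assoc_mult_mat_vec[OF Y(1) X] Y(2) by (metis one_mult_mat_vec)
  qed
qed

lemma sinh_ge_self:
  fixes x :: real
  assumes "x \<ge> 0"
  shows "x \<le> sinh x"
  using real_le_x_sinh[OF assms] by (simp add: sinh_field_def exp_minus)

text \<open>This is tanh x < x without division: the difference of the two sides vanishes at 0 and
  has derivative x sinh x > 0.\<close>

lemma sinh_less_mult_cosh:
  fixes x :: real
  assumes "x > 0"
  shows "sinh x < x * cosh x"
proof -
  have "(\<lambda>x. x * cosh x - sinh x) 0 < (\<lambda>x. x * cosh x - sinh x) x"
    using assms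
  proof (rule DERIV_pos_imp_increasing_open)
    fix y :: real
    assume "0 < y" "y < x"
    then show "\<exists>d. ((\<lambda>x. x * cosh x - sinh x) has_real_derivative d) (at y) \<and> d > 0"
      by (intro exI[of _ "y * sinh y"]) (auto intro!: derivative_eq_intros)
  qed (auto intro!: continuous_intros)
  then show ?thesis by simp
qed

text \<open>Rearranged, the claim is 2 sinh x < x (cosh x + 1). With x = 2y the sides become 4 sinh
  y cosh y and 4 y cosh(y)^2, so it is the previous inequality at y times 4 cosh y.\<close>

lemma sinh_minus_self_less:
  fixes x :: real
  assumes "x > 0"
  shows "sinh x - x < x * cosh x - sinh x"
proof -
  define y where "y = x / 2"
  have x: "x = 2 * y" and y: "y > 0"
    using assms by (auto simp: y_def)
  have "sinh y * (4 * cosh y) < y * cosh y * (4 * cosh y)"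
    using sinh_less_mult_cosh[OF y] by (intro mult_strict_right_mono) auto
  moreover have "2 * sinh x = sinh y * (4 * cosh y)"
    by (simp add: x sinh_double)
  moreover have "x * cosh x + x = y * cosh y * (4 * cosh y)"
    unfolding x cosh_double sinh_square_eq by (simp add: algebra_simps power2_eq_square)
  ultimately show ?thesis by linarith
qed

text \<open>Evaluates the off-diagonal row sums of a tri-diagonal matrix: an end row has one
  neighbour, an inner row two. \<open>0 < M\<close> excludes the 1 x 1 case, whose only row has
  none.\<close>

lemma sum_neighbours:
  fixes r :: real and j M :: nat
  assumes "0 < M" "j \<le> M"
  shows "(\<Sum>l \<in> {0..<M + 1} - {j}. if l + 1 = j \<or> l = j + 1 then r else 0) =
    (if j = 0 \<or> j = M then r else 2 * r)"
proof -
  let ?N = "{l. l \<le> M \<and> (l + 1 = j \<or> l = j + 1)}"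
  have "(\<Sum>l \<in> {0..<M + 1} - {j}. if l + 1 = j \<or> l = j + 1 then r else 0) = (\<Sum>l \<in> ?N. r)"
    by (intro sum.mono_neutral_cong_right) auto
  also have "\<dots> = real (card ?N) * r"
    by simp
  \<comment> \<open>The natural subtractions are genuine here: \<open>M > 0\<close>, and
    \<open>j > 0\<close> in the last branch.\<close>
  also have "?N = (if j = 0 then {1} else if j = M then {M - 1} else {j - 1, j + 1})"
    using assms by auto
  also have "real (card \<dots>) * r = (if j = 0 \<or> j = M then r else 2 * r)"
    by auto
  finally show ?thesis .
qed

lemma strictly_diag_dominant_mat_A:
  assumes "\<kappa> > 0" "p > 0" "h > 0" "\<tau> > 0" "M > 0"
  shows "strictly_diag_dominant (mat_A \<alpha> \<kappa> p h \<tau> M)"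
  unfolding strictly_diag_dominant_def
proof (intro conjI allI impI)
  let ?X = "mat_A \<alpha> \<kappa> p h \<tau> M"
  show "square_mat ?X" by (simp add: mat_A_def Let_def)
  fix j
  assume "j < dim_row ?X"
  then have j: "j \<le> M" by (simp add: mat_A_def Let_def)
  define z where "z = p * h"
  have z: "z > 0" using assms by (simp add: z_def)
  define d where "d = z * cosh z - sinh z"
  have d: "sinh z - z < d"
    unfolding d_def by (rule sinh_minus_self_less[OF z])
  have s: "sinh z > 0" using z by simp
  have c: "cosh z > 1" using cosh_real_strict_mono[of 0 z] z by simp
  have cols: "{0..<dim_col ?X} - {j} = {0..<M + 1} - {j}"
    by (simp add: mat_A_def Let_def)
  show "(\<Sum>l \<in> {0..<dim_col ?X} - {j}. \<bar>?X $$ (j, l)\<bar>) < \<bar>?X $$ (j, j)\<bar>"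
  proof (cases "j = 0 \<or> j = M")
    case True
    have "(\<Sum>l \<in> {0..<M + 1} - {j}. \<bar>?X $$ (j, l)\<bar>) = 0"
      using True j by (intro sum.neutral) (auto simp: mat_A_def Let_def)
    moreover have "?X $$ (j, j) = 2 * (\<tau> powr \<alpha>) * \<kappa> * p ^ 3 * h * sinh z * (cosh z - 1)"
      using True j by (auto simp: mat_A_def Let_def z_def)
    moreover have "\<dots> > 0"
      using assms s c by simp
    ultimately show ?thesis unfolding cols by simp
  next
    case False
    \<comment> \<open>The diffusion part of the row. As \<open>omega \<alpha> 0\<close> is 1, the
      neighbours are -q + (sinh z - z) and the diagonal is 2 (q + d).\<close>
    define q where "q = \<tau> powr \<alpha> * \<kappa> * p ^ 2 * sinh z"
    have q: "q > 0" using assms s by (simp add: q_def)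
    have "(\<Sum>l \<in> {0..<M + 1} - {j}. \<bar>?X $$ (j, l)\<bar>) =
        (\<Sum>l \<in> {0..<M + 1} - {j}. if l + 1 = j \<or> l = j + 1 then \<bar>- q + (sinh z - z)\<bar> else 0)"
      using False j
      by (intro sum.cong) (auto simp: mat_A_def Let_def z_def q_def coeff_A_def omega_def)
    also have "\<dots> = 2 * \<bar>- q + (sinh z - z)\<bar>"
      using False sum_neighbours[OF assms(5) j] by simp
    \<comment> \<open>The sign of the neighbour entry depends on the mesh, so the triangle
      inequality is used: its modulus is at most q + (sinh z - z), and sinh z - z < d.\<close>
    also have "\<bar>- q + (sinh z - z)\<bar> < q + d"
      using sinh_ge_self[OF less_imp_le[OF z]] d q by linarith
    also have "2 * (q + d) = ?X $$ (j, j)"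
      using False j by (auto simp: mat_A_def Let_def z_def q_def d_def coeff_A'_def omega_def)
    finally show ?thesis unfolding cols by linarith
  qed
qed

text \<open>An inner row doubles both the diagonal and the off-diagonal sum of an end row, so every
  row reduces to sinh z - z < d.\<close>

lemma strictly_diag_dominant_mat_K:
  assumes "p > 0" "h > 0" "M > 0"
  shows "strictly_diag_dominant (mat_K p h M)"
  unfolding strictly_diag_dominant_def
proof (intro conjI allI impI)
  let ?X = "mat_K p h M"
  show "square_mat ?X" by (simp add: mat_K_def Let_def)
  fix j
  assume "j < dim_row ?X"
  then have j: "j \<le> M" by (simp add: mat_K_def Let_def)
  define z where "z = p * h"
  have z: "z > 0" using assms by (simp add: z_def)
  define d where "d = z * cosh z - sinh z"
  have ineqs: "z \<le> sinh z" "sinh z - z < d"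
    unfolding d_def using z sinh_ge_self sinh_minus_self_less by auto
  have cols: "{0..<dim_col ?X} - {j} = {0..<M + 1} - {j}"
    by (simp add: mat_K_def Let_def)
  have off: "(\<Sum>l \<in> {0..<M + 1} - {j}. \<bar>?X $$ (j, l)\<bar>) =
      (\<Sum>l \<in> {0..<M + 1} - {j}. if l + 1 = j \<or> l = j + 1 then sinh z - z else 0)"
    using j ineqs by (intro sum.cong) (auto simp: mat_K_def Let_def z_def)
  show "(\<Sum>l \<in> {0..<dim_col ?X} - {j}. \<bar>?X $$ (j, l)\<bar>) < \<bar>?X $$ (j, j)\<bar>"
  proof (cases "j = 0 \<or> j = M")
    case True
    have "(\<Sum>l \<in> {0..<M + 1} - {j}. \<bar>?X $$ (j, l)\<bar>) = sinh z - z"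
      using True sum_neighbours[OF assms(3) j] unfolding off by simp
    moreover have "?X $$ (j, j) = d"
      using True j by (auto simp: mat_K_def Let_def z_def d_def)
    ultimately show ?thesis using ineqs unfolding cols by linarith
  next
    case False
    have "(\<Sum>l \<in> {0..<M + 1} - {j}. \<bar>?X $$ (j, l)\<bar>) = 2 * (sinh z - z)"
      using False sum_neighbours[OF assms(3) j] unfolding off by simp
    moreover have "?X $$ (j, j) = 2 * d"
      using False j by (auto simp: mat_K_def Let_def z_def d_def)
    ultimately show ?thesis using ineqs unfolding cols by simp
  qed
qed

text \<open>Whatever the data and the earlier vectors \<open>w k\<close>, each right-hand side is a
  fixed vector of dimension \<open>M + 1\<close>, so solvability depends on the coefficient matrix
  alone.\<close>

theorem lemma5p1:
  fixes \<alpha> \<kappa> p a b T h \<tau> :: real and M N :: nat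
    and f :: "real \<Rightarrow> real \<Rightarrow> real" and \<phi> \<phi>' g1 g2 :: "real \<Rightarrow> real"
  assumes "0 < \<alpha>" and "\<alpha> < 1" and "\<kappa> > 0" and "p > 0" and "a < b" and "T > 0"
    and "M > 0" and "N > 0"
    and "h = (b - a) / real M" and "\<tau> = T / real N"
    and "\<And>x. x \<in> {a..b} \<Longrightarrow> (\<phi> has_real_derivative \<phi>' x) (at x within {a..b})"
  shows "strictly_diag_dominant (mat_A \<alpha> \<kappa> p h \<tau> M)
    \<and> strictly_diag_dominant (mat_K p h M)
    \<and> (\<exists>!v. v \<in> carrier_vec (M + 1) \<and> mat_K p h M *\<^sub>v v = rhs_U p a h M \<phi> \<phi>')
    \<and> (\<forall>n\<in>{1..N}. \<forall>w :: nat \<Rightarrow> real vec. (\<forall>k<n. w k \<in> carrier_vec (M + 1)) \<longrightarrow>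
        (\<exists>!v. v \<in> carrier_vec (M + 1) \<and>
          mat_A \<alpha> \<kappa> p h \<tau> M *\<^sub>v v =
            - finsum_vec TYPE(real) (M + 1)
                (\<lambda>k. omega \<alpha> k \<cdot>\<^sub>v (mat_B p h M *\<^sub>v w (n - k))) {1..<n}
            + finsum_vec TYPE(real) (M + 1)
                (\<lambda>k. omega \<alpha> k \<cdot>\<^sub>v (mat_B p h M *\<^sub>v w 0)) {0..<n}
            + rhs_F \<alpha> \<kappa> p a h \<tau> M f \<phi> g1 g2 n))"
proof -
  have h: "h > 0" and \<tau>: "\<tau> > 0"
    using assms(5-10) by simp_all
  have A: "mat_A \<alpha> \<kappa> p h \<tau> M \<in> carrier_mat (M + 1) (M + 1)"
    and K: "mat_K p h M \<in> carrier_mat (M + 1) (M + 1)"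
    by (simp_all add: mat_A_def mat_K_def Let_def)
  have U: "rhs_U p a h M \<phi> \<phi>' \<in> carrier_vec (M + 1)"
    by (simp add: rhs_U_def Let_def)
  have F: "rhs_F \<alpha> \<kappa> p a h \<tau> M f \<phi> g1 g2 n \<in> carrier_vec (M + 1)" for n
    by (simp add: rhs_F_def Let_def)
  \<comment> \<open>A matrix-vector product takes its dimension from the rows of the matrix, so
    \<open>w\<close> is arbitrary here.\<close>
  have Bw: "x \<cdot>\<^sub>v (mat_B p h M *\<^sub>v w) \<in> carrier_vec (M + 1)" for x w
    by (rule carrier_vecI) (simp add: mat_B_def Let_def)
  have domA: "strictly_diag_dominant (mat_A \<alpha> \<kappa> p h \<tau> M)"
    using assms h \<tau> by (intro strictly_diag_dominant_mat_A)
  have domK: "strictly_diag_dominant (mat_K p h M)"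
    using assms h by (intro strictly_diag_dominant_mat_K)
  show ?thesis
  proof (intro conjI ballI allI impI)
    fix n and w :: "nat \<Rightarrow> real vec"
    \<comment> \<open>Stated for a family \<open>u\<close> to cover both sums: \<open>u k\<close> is
      \<open>w (n - k)\<close> in the first and the constant \<open>w 0\<close> in the
      second.\<close>
    have sum: "finsum_vec TYPE(real) (M + 1) (\<lambda>k. omega \<alpha> k \<cdot>\<^sub>v (mat_B p h M *\<^sub>v u k)) I
        \<in> carrier_vec (M + 1)" for u I
      using Bw by (intro finsum_vec_closed) blast
    show "\<exists>!v. v \<in> carrier_vec (M + 1) \<and>
        mat_A \<alpha> \<kappa> p h \<tau> M *\<^sub>v v =
          - finsum_vec TYPE(real) (M + 1)
              (\<lambda>k. omega \<alpha> k \<cdot>\<^sub>v (mat_B p h M *\<^sub>v w (n - k))) {1..<n}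
          + finsum_vec TYPE(real) (M + 1)
              (\<lambda>k. omega \<alpha> k \<cdot>\<^sub>v (mat_B p h M *\<^sub>v w 0)) {0..<n}
          + rhs_F \<alpha> \<kappa> p a h \<tau> M f \<phi> g1 g2 n"
      by (intro strictly_diag_dominant_ex1_solution[OF A domA] add_carrier_vec
          uminus_carrier_vec[THEN iffD2] sum F)
  qed (fact domA domK strictly_diag_dominant_ex1_solution[OF K domK U])+
qed

end
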